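(* Under the assumptions of Theorem 2.5 (i.e. $B$ centered Gaussian with stationary increments, $B_0=0$, $X_t=\theta t+B_t$, $h>0$, $(B_{kh})_{k=1}^N$ nonsingular for every $N$, and $\mathbb{E}[(B_{(k+1)h}-B_{kh})B_h]\to0$ as $k\to\infty$), the maximum likelihood estimator $$\hat\theta^{(N)}=\frac{z^\top(\Gamma^{(N)})^{-1}\Delta X^{(N)}}{z^\top(\Gamma^{(N)})^{-1}z},\qquad z=(h,\dots,h)^\top\in\mathbb{R}^N,$$ is strongly consistent: $\hat\theta^{(N)}\to\theta$ almost surely as $N\to\infty$.
   Context: $\Delta X^{(N)}=(X_{kh}-X_{(k-1)h})_{k=1}^N$, $\Delta B^{(N)}=(B_{kh}-B_{(k-1)h})_{k=1}^N$, and $\Gamma^{(N)}$ is the covariance matrix of $\Delta B^{(N)}$; all estimators are defined on the same probability space from a single trajectory of $X$. *)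

theory Defs
  imports "HOL-Probability.Probability" "Jordan_Normal_Form.Gauss_Jordan_Elimination" "Jordan_Normal_Form.Determinant"
begin

definition cov :: "'a measure \<Rightarrow> ('a \<Rightarrow> real) \<Rightarrow> ('a \<Rightarrow> real) \<Rightarrow> real" where
  "cov M Y Z = (\<integral>\<omega>. (Y \<omega> - (\<integral>\<omega>'. Y \<omega>' \<partial>M)) * (Z \<omega> - (\<integral>\<omega>'. Z \<omega>' \<partial>M)) \<partial>M)"

definition centered_gaussian_rv :: "'a measure \<Rightarrow> ('a \<Rightarrow> real) \<Rightarrow> bool" where
  "centered_gaussian_rv M Y \<longleftrightarrow> Y \<in> borel_measurable M \<and>
     ((\<exists>\<sigma>>0. distributed M lborel Y (normal_density 0 \<sigma>)) \<or> (AE \<omega> in M. Y \<omega> = 0))"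

definition centered_gaussian_process :: "'a measure \<Rightarrow> (real \<Rightarrow> 'a \<Rightarrow> real) \<Rightarrow> bool" where
  "centered_gaussian_process M B \<longleftrightarrow>
     (\<forall>n (t :: nat \<Rightarrow> real) (c :: nat \<Rightarrow> real). (\<forall>i<n. t i \<ge> 0) \<longrightarrow>
        centered_gaussian_rv M (\<lambda>\<omega>. \<Sum>i<n. c i * B (t i) \<omega>))"

definition stationary_increments :: "'a measure \<Rightarrow> (real \<Rightarrow> 'a \<Rightarrow> real) \<Rightarrow> bool" where
  "stationary_increments M B \<longleftrightarrow>
     (\<forall>s n (t :: nat \<Rightarrow> real). s \<ge> 0 \<longrightarrow> (\<forall>i<n. t i \<ge> 0) \<longrightarrow>
        distr M (PiM {..<n} (\<lambda>_. borel)) (\<lambda>\<omega>. \<lambda>i\<in>{..<n}. B (s + t i) \<omega> - B s \<omega>) =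
        distr M (PiM {..<n} (\<lambda>_. borel)) (\<lambda>\<omega>. \<lambda>i\<in>{..<n}. B (t i) \<omega> - B 0 \<omega>))"

text \<open>Covariance matrix of (B_{kh})_{k=1}^N (0-based index i \<leftrightarrow> k = i+1).\<close>
definition cov_B_mat :: "'a measure \<Rightarrow> (real \<Rightarrow> 'a \<Rightarrow> real) \<Rightarrow> real \<Rightarrow> nat \<Rightarrow> real mat" where
  "cov_B_mat M B h N = mat N N (\<lambda>(i,j). cov M (B (real (Suc i) * h)) (B (real (Suc j) * h)))"

definition Gamma_mat :: "'a measure \<Rightarrow> (real \<Rightarrow> 'a \<Rightarrow> real) \<Rightarrow> real \<Rightarrow> nat \<Rightarrow> real mat" where
  "Gamma_mat M B h N = mat N N (\<lambda>(i,j).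
     cov M (\<lambda>\<omega>. B (real (Suc i) * h) \<omega> - B (real i * h) \<omega>)
           (\<lambda>\<omega>. B (real (Suc j) * h) \<omega> - B (real j * h) \<omega>))"

definition incr_vec :: "(real \<Rightarrow> 'a \<Rightarrow> real) \<Rightarrow> real \<Rightarrow> nat \<Rightarrow> 'a \<Rightarrow> real vec" where
  "incr_vec X h N \<omega> = vec N (\<lambda>i. X (real (Suc i) * h) \<omega> - X (real i * h) \<omega>)"

definition theta_hat :: "'a measure \<Rightarrow> (real \<Rightarrow> 'a \<Rightarrow> real) \<Rightarrow> (real \<Rightarrow> 'a \<Rightarrow> real)
    \<Rightarrow> real \<Rightarrow> nat \<Rightarrow> 'a \<Rightarrow> real" where
  "theta_hat M B X h N \<omega> =
     (let z = vec N (\<lambda>_. h); G = the (mat_inverse (Gamma_mat M B h N))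
      in scalar_prod z (G *\<^sub>v incr_vec X h N \<omega>) / scalar_prod z (G *\<^sub>v z))"

end

(* The estimation error S_N is the best linear unbiased estimator built from the first N increments of B, so
   E (S_N U) = v_N := Var S_N for every unbiased linear estimator U in those increments. Hence
   E (S_K - S_N)^2 = v_K - v_N for K <= N, and v_N -> 0 by comparison with the average of sparsely chosen
   increments, which are almost uncorrelated. By Gaussianity E (S_K - S_N)^4 = 3 (v_K - v_N)^2, and a
   maximal inequality for fourth moments of Billingsley type turns this into almost sure convergence, so
   independence of the increments of S is not needed. *)
theory Submission
  imports Defs
begin

section \<open>Moments of centered Gaussian variables\<close>

text \<open>The factor is the Gaussian ratio 4! / (2^2 * 2!) = 3, through which variances control
  fourth moments. The degenerate alternative has to be covered because a difference of linear
  combinations may vanish almost surely.\<close>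

lemma (in prob_space) centered_gaussian_rv_moments:
  assumes "centered_gaussian_rv M Y"
  shows "integrable M (\<lambda>\<omega>. Y \<omega> ^ k)"
    and "expectation Y = 0"
    and "expectation (\<lambda>\<omega>. Y \<omega> ^ 4) = 3 * (expectation (\<lambda>\<omega>. (Y \<omega>)\<^sup>2))\<^sup>2"
proof -
  have [measurable]: "Y \<in> borel_measurable M"
    using assms by (simp add: centered_gaussian_rv_def)
  consider \<sigma> where "\<sigma> > 0" "distributed M lborel Y (normal_density 0 \<sigma>)" | "AE \<omega> in M. Y \<omega> = 0"
    using assms by (auto simp: centered_gaussian_rv_def)
  then have "integrable M (\<lambda>\<omega>. Y \<omega> ^ k) \<and> expectation Y = 0 \<and>
    expectation (\<lambda>\<omega>. Y \<omega> ^ 4) = 3 * (expectation (\<lambda>\<omega>. (Y \<omega>)\<^sup>2))\<^sup>2"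
  proof cases
    case 1
    have eq: "expectation (\<lambda>\<omega>. Y \<omega> ^ n) = (\<integral>x. normal_density 0 \<sigma> x * x ^ n \<partial>lborel)" for n
      using distributed_integral[OF 1(2), of "\<lambda>x. x ^ n"] by simp
    have "integrable M (\<lambda>\<omega>. Y \<omega> ^ k)"
      using distributed_integrable[OF 1(2), of "\<lambda>x. x ^ k"] integrable_normal_moment[OF 1(1), of 0 k]
      by simp
    moreover have "expectation Y = 0"
      using normal_distributed_expectation[OF 1] .
    moreover have "expectation (\<lambda>\<omega>. Y \<omega> ^ 4) = 3 * \<sigma> ^ 4"
      using eq[of 4] integral_normal_moment_even[OF 1(1), of 0 2] 1(1)
      by (simp add: fact_numeral field_simps power_divide)
    moreover have "expectation (\<lambda>\<omega>. (Y \<omega>)\<^sup>2) = \<sigma>\<^sup>2"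
      unfolding eq using integral_normal_moment_even[OF 1(1), of 0 1] 1(1)
      by (simp add: power2_eq_square field_simps)
    ultimately show ?thesis by simp
  next
    case 2
    have pow: "AE \<omega> in M. Y \<omega> ^ n = 0" if "n > 0" for n
      using 2 that by (auto simp: power_0_left elim!: eventually_mono)
    have int0: "expectation (\<lambda>\<omega>. Y \<omega> ^ n) = 0" if "n > 0" for n
      using pow[OF that] by (intro integral_eq_zero_AE)
    have "integrable M (\<lambda>\<omega>. Y \<omega> ^ k)"
    proof (cases "k = 0")
      case False
      then show ?thesis
        using pow[of k] integrable_cong_AE[of "\<lambda>\<omega>. Y \<omega> ^ k" M "\<lambda>_. 0"] by simp
    qed simp
    then show ?thesis
      using int0[of 1] int0[of 2] int0[of 4] by simp
  qed
  then show "integrable M (\<lambda>\<omega>. Y \<omega> ^ k)" "expectation Y = 0"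
    "expectation (\<lambda>\<omega>. Y \<omega> ^ 4) = 3 * (expectation (\<lambda>\<omega>. (Y \<omega>)\<^sup>2))\<^sup>2"
    by auto
qed

section \<open>A maximal inequality for fourth moments\<close>

text \<open>The coefficient of \<open>x ^ 4\<close> must be below 2 for the constant in \<open>maximal_inequality\<close> to reproduce
  itself: the variance is halved, so its square is quartered, on each of two pieces.\<close>
lemma power4_add_le: "(x + y) ^ 4 \<le> 3/2 * x ^ 4 + 15000 * y ^ 4" for x y :: real
\<comment> \<open>The threshold 1/10 works because (11/10)^4 = 1.4641 < 3/2; beyond it the sum is at
  most 11 times \<open>y\<close> in absolute value, and 11^4 = 14641 < 15000.\<close>
proof (cases "\<bar>y\<bar> \<le> \<bar>x\<bar> / 10")
  case True
  then have "\<bar>x + y\<bar> ^ 4 \<le> (11/10 * \<bar>x\<bar>) ^ 4"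
    by (intro power_mono) (linarith, simp)
  then have "(x + y) ^ 4 \<le> (11/10) ^ 4 * x ^ 4"
    by (simp add: power_mult_distrib power_divide power_even_abs)
  moreover have "(11/10) ^ 4 * x ^ 4 \<le> 3/2 * x ^ 4"
    by (intro mult_right_mono) (auto simp: power_divide)
  moreover have "0 \<le> y ^ 4" by simp
  ultimately show ?thesis by linarith
next
  case False
  then have "\<bar>x + y\<bar> ^ 4 \<le> (11 * \<bar>y\<bar>) ^ 4"
    by (intro power_mono) auto
  then have "(x + y) ^ 4 \<le> 14641 * y ^ 4"
    by (simp add: power_mult_distrib power_even_abs)
  moreover have "0 \<le> y ^ 4" "0 \<le> x ^ 4" by simp_all
  ultimately show ?thesis by linarith
qed

text \<open>Induction on the length of the interval, which is bisected by variance rather than by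
  index. The two pieces together cost at most 2 * 3/2 * 1/4 = 3/4 of the constant, and the remaining
  quarter, 15000 * \<open>C\<close>, pays for the difference that joins them. An integrable majorant
  stands in for the pointwise maximum, so that the majorants of the pieces can simply be
  added.\<close>

lemma maximal_inequality:
  fixes f :: "nat \<Rightarrow> 'a \<Rightarrow> real" and v :: "nat \<Rightarrow> real"
  assumes int: "\<And>i j. integrable M (\<lambda>\<omega>. (f j \<omega> - f i \<omega>) ^ 4)"
    and bound: "\<And>i j. i \<le> j \<Longrightarrow> (\<integral>\<omega>. (f j \<omega> - f i \<omega>) ^ 4 \<partial>M) \<le> C * (v i - v j)\<^sup>2"
    and v: "antimono v" and C: "C \<ge> 0" and "a \<le> b"
  shows "\<exists>G. integrable M G \<and> (\<forall>\<omega>. \<forall>k\<in>{a..b}. (f k \<omega> - f a \<omega>) ^ 4 \<le> G \<omega>) \<and>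
    integral\<^sup>L M G \<le> 60000 * C * (v a - v b)\<^sup>2"
  using \<open>a \<le> b\<close>
proof (induction "b - a" arbitrary: a b rule: less_induct)
  case less
  show ?case
  proof (cases "a = b")
    case True
    then show ?thesis by (intro exI[of _ "\<lambda>_. 0"]) auto
  next
    case False
    with less.prems have ab: "a < b" by simp
    define U where "U = v a - v b"
    have U: "U \<ge> 0" using antimonoD[OF v less.prems] by (simp add: U_def)
    \<comment> \<open>Split at \<open>m\<close> so that both \<open>{a..m}\<close> and \<open>{Suc m..b}\<close> carry at most half of the variance.\<close>
    define S where "S = {k\<in>{a..<b}. v a - v k \<le> U / 2}"
    have S: "finite S" "a \<in> S" using ab U by (auto simp: S_def)
    define m where "m = Max S"
    have "m \<in> S" unfolding m_def by (rule Max_in) (use S in auto)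
    then have m: "a \<le> m" "m < b" "v a - v m \<le> U / 2" by (auto simp: S_def)
    have m': "v (Suc m) - v b \<le> U / 2"
    proof (cases "Suc m = b")
      case True
      then show ?thesis using U by simp
    next
      case False
      \<comment> \<open>By maximality of \<open>m\<close>, more than half of the variance is used up
        at \<open>Suc m\<close>, so less than half is left after it.\<close>
      have "Suc m \<notin> S" using Max_ge[OF S(1), of "Suc m"] by (auto simp: m_def)
      then have "v a - v (Suc m) > U / 2" using False m by (auto simp: S_def)
      then show ?thesis by (simp add: U_def)
    qed
    obtain G1 where G1: "integrable M G1" "\<And>\<omega> k. k \<in> {a..m} \<Longrightarrow> (f k \<omega> - f a \<omega>) ^ 4 \<le> G1 \<omega>"
      "integral\<^sup>L M G1 \<le> 60000 * C * (v a - v m)\<^sup>2"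
      using less.hyps[OF diff_less_mono[OF m(2,1)] m(1)] by blast
    obtain G2 where G2: "integrable M G2"
      "\<And>\<omega> k. k \<in> {Suc m..b} \<Longrightarrow> (f k \<omega> - f (Suc m) \<omega>) ^ 4 \<le> G2 \<omega>"
      "integral\<^sup>L M G2 \<le> 60000 * C * (v (Suc m) - v b)\<^sup>2"
      using less.hyps[OF _ Suc_leI[OF m(2)]] diff_less_mono2[OF le_imp_less_Suc[OF m(1)] ab] by blast
    \<comment> \<open>Indices beyond \<open>m\<close> are reached from \<open>a\<close> through
      \<open>Suc m\<close>, and \<open>power4_add_le\<close> charges the factor 15000 to that
      joining difference.\<close>
    define G where "G = (\<lambda>\<omega>. 3/2 * G1 \<omega> + 3/2 * G2 \<omega> + 15000 * (f (Suc m) \<omega> - f a \<omega>) ^ 4)"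
    have "integrable M G"
      unfolding G_def using G1(1) G2(1) int by (intro Bochner_Integration.integrable_add) auto
    moreover have "(f k \<omega> - f a \<omega>) ^ 4 \<le> G \<omega>" if k: "k \<in> {a..b}" for k \<omega>
    proof -
      have nonneg: "0 \<le> G1 \<omega>" "0 \<le> G2 \<omega>" "0 \<le> (f (Suc m) \<omega> - f a \<omega>) ^ 4"
        using G1(2)[of a \<omega>] G2(2)[of "Suc m" \<omega>] m by auto
      show ?thesis
      proof (cases "k \<le> m")
        case True
        then have "(f k \<omega> - f a \<omega>) ^ 4 \<le> G1 \<omega>" using G1(2)[of k \<omega>] k by auto
        then show ?thesis using nonneg unfolding G_def by linarith
      next
        case False
        then have "(f k \<omega> - f (Suc m) \<omega>) ^ 4 \<le> G2 \<omega>" using G2(2)[of k \<omega>] k by auto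
        then show ?thesis
          using power4_add_le[of "f k \<omega> - f (Suc m) \<omega>" "f (Suc m) \<omega> - f a \<omega>"] nonneg
          unfolding G_def by auto
      qed
    qed
    moreover have "integral\<^sup>L M G \<le> 60000 * C * U\<^sup>2"
    proof -
      have sq: "(v a - v m)\<^sup>2 \<le> (U / 2)\<^sup>2" "(v (Suc m) - v b)\<^sup>2 \<le> (U / 2)\<^sup>2" "(v a - v (Suc m))\<^sup>2 \<le> U\<^sup>2"
        using m m' antimonoD[OF v, of a m] antimonoD[OF v, of "Suc m" b] antimonoD[OF v, of a "Suc m"]
        by (auto simp: U_def intro!: power_mono)
      have "integral\<^sup>L M G = 3/2 * integral\<^sup>L M G1 + 3/2 * integral\<^sup>L M G2
          + 15000 * (\<integral>\<omega>. (f (Suc m) \<omega> - f a \<omega>) ^ 4 \<partial>M)"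
        unfolding G_def using G1(1) G2(1) int by simp
      also have "\<dots> \<le> 3/2 * (60000 * C * (U/2)\<^sup>2) + 3/2 * (60000 * C * (U/2)\<^sup>2) + 15000 * (C * U\<^sup>2)"
        using G1(3) G2(3) bound[of a "Suc m"] m C
          mult_left_mono[OF sq(1), of "60000 * C"] mult_left_mono[OF sq(2), of "60000 * C"]
          mult_left_mono[OF sq(3), of C]
        by (intro add_mono mult_left_mono) auto
      also have "\<dots> = 60000 * C * U\<^sup>2"
        by (simp add: power2_eq_square)
      finally show ?thesis .
    qed
    ultimately show ?thesis unfolding U_def by blast
  qed
qed

section \<open>From fourth moments to almost sure convergence\<close>

lemma AE_summable_of_summable_integral:
  fixes H :: "nat \<Rightarrow> 'a \<Rightarrow> real"
  assumes [measurable]: "\<And>j. integrable M (H j)" and nonneg: "\<And>j \<omega>. 0 \<le> H j \<omega>"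
    and sum: "summable (\<lambda>j. integral\<^sup>L M (H j))"
  shows "AE \<omega> in M. summable (\<lambda>j. H j \<omega>)"
proof -
  have [measurable]: "H j \<in> borel_measurable M" for j using assms(1) by auto
  have "(\<integral>\<^sup>+\<omega>. (\<Sum>j. ennreal (H j \<omega>)) \<partial>M) = (\<Sum>j. \<integral>\<^sup>+\<omega>. ennreal (H j \<omega>) \<partial>M)"
    by (intro nn_integral_suminf) simp
  also have "\<dots> = (\<Sum>j. ennreal (integral\<^sup>L M (H j)))"
    using assms(1) nonneg by (intro suminf_cong nn_integral_eq_integral) auto
  also have "\<dots> = ennreal (\<Sum>j. integral\<^sup>L M (H j))"
    using sum nonneg by (intro suminf_ennreal2) auto
  finally have "(\<integral>\<^sup>+\<omega>. (\<Sum>j. ennreal (H j \<omega>)) \<partial>M) \<noteq> \<infinity>" by simp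
  then have "AE \<omega> in M. (\<Sum>j. ennreal (H j \<omega>)) \<noteq> \<infinity>"
    by (intro nn_integral_PInf_AE) auto
  then show ?thesis
    by (rule eventually_mono) (auto intro!: summable_suminf_not_top nonneg)
qed

text \<open>Along a subsequence \<open>r\<close> on which \<open>v\<close> decays geometrically, the
  fourth moments of the values \<open>f (r j)\<close> and of the fluctuations between consecutive
  \<open>r j\<close> are summable. Both therefore tend to 0 almost surely, and every index from
  \<open>r 0\<close> on lies in one of these blocks.\<close>

lemma AE_tendsto_0_of_fourth_moments:
  fixes f :: "nat \<Rightarrow> 'a \<Rightarrow> real" and v :: "nat \<Rightarrow> real"
  assumes int: "\<And>i j. integrable M (\<lambda>\<omega>. (f j \<omega> - f i \<omega>) ^ 4)"
    and bound: "\<And>i j. i \<le> j \<Longrightarrow> (\<integral>\<omega>. (f j \<omega> - f i \<omega>) ^ 4 \<partial>M) \<le> C * (v i - v j)\<^sup>2"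
    and int0: "\<And>i. integrable M (\<lambda>\<omega>. (f i \<omega>) ^ 4)"
    and bound0: "\<And>i. (\<integral>\<omega>. (f i \<omega>) ^ 4 \<partial>M) \<le> C * (v i)\<^sup>2"
    and v: "antimono v" and lim: "v \<longlonglongrightarrow> 0" and C: "C \<ge> 0"
  shows "AE \<omega> in M. (\<lambda>n. f n \<omega>) \<longlonglongrightarrow> 0"
proof -
  have v0: "v i \<ge> 0" for i
    using decseq_ge[OF v lim] .
  have "\<exists>n>m. v n \<le> (1/2) ^ j" for m j
  proof -
    have "eventually (\<lambda>n. v n < (1/2) ^ j) sequentially"
      using order_tendstoD(2)[OF lim, of "(1/2) ^ j"] by simp
    then obtain n0 where "\<And>n. n \<ge> n0 \<Longrightarrow> v n < (1/2) ^ j"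
      by (auto simp: eventually_sequentially)
    then show ?thesis by (intro exI[of _ "max n0 (Suc m)"]) (auto intro: less_imp_le)
  qed
  then obtain r where r: "\<And>j. v (r j) \<le> (1/2) ^ j" "\<And>j. r j < r (Suc j)"
    using dependent_nat_choice[of "\<lambda>j n. v n \<le> (1/2) ^ j" "\<lambda>_ m n. m < n"] by blast
  have "\<exists>G. integrable M G \<and> (\<forall>\<omega>. \<forall>k\<in>{r j..r (Suc j)}. (f k \<omega> - f (r j) \<omega>) ^ 4 \<le> G \<omega>) \<and>
    integral\<^sup>L M G \<le> 60000 * C * (v (r j) - v (r (Suc j)))\<^sup>2" for j
    using r(2)[of j] by (intro maximal_inequality int bound v C) auto
  then obtain G where G: "\<And>j. integrable M (G j)"
    "\<And>j \<omega> k. k \<in> {r j..r (Suc j)} \<Longrightarrow> (f k \<omega> - f (r j) \<omega>) ^ 4 \<le> G j \<omega>"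
    "\<And>j. integral\<^sup>L M (G j) \<le> 60000 * C * (v (r j) - v (r (Suc j)))\<^sup>2"
    by metis
  \<comment> \<open>One function controls both the fluctuation inside block \<open>j\<close> and the
    value at its left end.\<close>
  define H where "H = (\<lambda>j \<omega>. G j \<omega> + (f (r j) \<omega>) ^ 4)"
  have G0: "0 \<le> G j \<omega>" for j \<omega>
    using G(2)[of "r j" j \<omega>] r(2)[of j] by auto
  have H_int: "integrable M (H j)" for j
    unfolding H_def using G(1) int0 by auto
  have H_nonneg: "0 \<le> H j \<omega>" for j \<omega>
    using G0 by (simp add: H_def)
  have H_le: "integral\<^sup>L M (H j) \<le> 60001 * C * (1/4) ^ j" for j
  proof -
    have "integral\<^sup>L M (H j) = integral\<^sup>L M (G j) + (\<integral>\<omega>. (f (r j) \<omega>) ^ 4 \<partial>M)"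
      unfolding H_def using G(1) int0 by simp
    also have "\<dots> \<le> 60000 * C * (v (r j) - v (r (Suc j)))\<^sup>2 + C * (v (r j))\<^sup>2"
      by (intro add_mono G(3) bound0)
    also have "\<dots> \<le> 60000 * C * ((1/2) ^ j)\<^sup>2 + C * ((1/2) ^ j)\<^sup>2"
    proof (intro add_mono mult_left_mono power_mono)
      show "v (r j) - v (r (Suc j)) \<le> (1/2) ^ j"
        using r(1)[of j] v0[of "r (Suc j)"] by linarith
      show "0 \<le> v (r j) - v (r (Suc j))"
        using antimonoD[OF v, of "r j" "r (Suc j)"] r(2)[of j] by simp
    qed (use r(1) v0 C in auto)
    also have "((1/2::real) ^ j)\<^sup>2 = (1/4) ^ j"
      by (simp add: power2_eq_square flip: power_mult_distrib)
    finally show ?thesis by simp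
  qed
  have "summable (\<lambda>j. integral\<^sup>L M (H j))"
  proof (rule summable_comparison_test')
    show "summable (\<lambda>j. 60001 * C * (1/4::real) ^ j)"
      by (intro summable_mult summable_geometric) simp
    show "norm (integral\<^sup>L M (H j)) \<le> 60001 * C * (1/4::real) ^ j" if "j \<ge> 0" for j
      using H_le[of j] H_nonneg by (simp add: integral_nonneg_AE)
  qed
  then have "AE \<omega> in M. summable (\<lambda>j. H j \<omega>)"
    using H_int H_nonneg by (intro AE_summable_of_summable_integral)
  then show ?thesis
  proof (rule eventually_mono)
    fix \<omega> assume "summable (\<lambda>j. H j \<omega>)"
    then have H0: "(\<lambda>j. H j \<omega>) \<longlonglongrightarrow> 0" by (rule summable_LIMSEQ_zero)
    show "(\<lambda>n. f n \<omega>) \<longlonglongrightarrow> 0"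
    proof (rule LIMSEQ_I)
      fix \<epsilon> :: real assume \<epsilon>: "\<epsilon> > 0"
      \<comment> \<open>On block \<open>j\<close> the fourth power of \<open>f k\<close> is at most
        15000 times \<open>H j\<close>, by \<open>power4_add_le\<close>.\<close>
      have "eventually (\<lambda>j. H j \<omega> < \<epsilon> ^ 4 / 15000) sequentially"
        using order_tendstoD(2)[OF H0, of "\<epsilon> ^ 4 / 15000"] \<epsilon> by simp
      then obtain j0 where j0: "\<And>j. j \<ge> j0 \<Longrightarrow> H j \<omega> < \<epsilon> ^ 4 / 15000"
        by (auto simp: eventually_sequentially)
      have mono: "strict_mono r" using r(2) by (simp add: strict_mono_Suc_iff)
      have "norm (f k \<omega> - 0) < \<epsilon>" if k: "k \<ge> r j0" for k
      proof -
        \<comment> \<open>The block that contains \<open>k\<close>.\<close>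
        define j where "j = Max {j. r j \<le> k}"
        have fin: "finite {j. r j \<le> k}"
          by (rule finite_subset[of _ "{..k}"])
            (use strict_mono_imp_increasing[OF mono] in \<open>auto intro: order_trans\<close>)
        have "j \<in> {j. r j \<le> k}" unfolding j_def by (rule Max_in) (use fin k in auto)
        moreover have "j \<ge> j0" unfolding j_def by (rule Max_ge) (use fin k in auto)
        moreover have "\<not> r (Suc j) \<le> k"
          using Max_ge[OF fin, of "Suc j"] by (auto simp: j_def)
        ultimately have j: "r j \<le> k" "k \<le> r (Suc j)" "j \<ge> j0" by auto
        have "(f k \<omega>) ^ 4 \<le> 3/2 * (f k \<omega> - f (r j) \<omega>) ^ 4 + 15000 * (f (r j) \<omega>) ^ 4"
          using power4_add_le[of "f k \<omega> - f (r j) \<omega>" "f (r j) \<omega>"] by simp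
        also have "\<dots> \<le> 15000 * H j \<omega>"
          using G(2)[of k j \<omega>] j G0[of j \<omega>] by (auto simp: H_def)
        also have "\<dots> < \<epsilon> ^ 4"
          using j0[OF j(3)] by simp
        finally have "\<bar>f k \<omega>\<bar> ^ 4 < \<epsilon> ^ 4" by (simp add: power_even_abs)
        then show ?thesis using power_less_imp_less_base[of "\<bar>f k \<omega>\<bar>" 4 \<epsilon>] \<epsilon> by simp
      qed
      then show "\<exists>no. \<forall>n\<ge>no. norm (f n \<omega> - 0) < \<epsilon>" by blast
    qed
  qed
qed

section \<open>Best linear unbiased estimation from stationary Gaussian increments\<close>

lemma (in prob_space) integrable_mult_centered_gaussian_rv:
  assumes Y: "centered_gaussian_rv M Y" and Z: "centered_gaussian_rv M Z"
  shows "integrable M (\<lambda>\<omega>. Y \<omega> * Z \<omega>)"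
proof (rule Bochner_Integration.integrable_bound)
  have [measurable]: "Y \<in> borel_measurable M" "Z \<in> borel_measurable M"
    using assms by (simp_all add: centered_gaussian_rv_def)
  show "(\<lambda>\<omega>. Y \<omega> * Z \<omega>) \<in> borel_measurable M" by measurable
  show "integrable M (\<lambda>\<omega>. (Y \<omega>)\<^sup>2 + (Z \<omega>)\<^sup>2)"
    by (intro Bochner_Integration.integrable_add centered_gaussian_rv_moments assms)
  show "AE \<omega> in M. norm (Y \<omega> * Z \<omega>) \<le> norm ((Y \<omega>)\<^sup>2 + (Z \<omega>)\<^sup>2)"
  proof (intro AE_I2)
    fix \<omega>
    have "2 * (\<bar>Y \<omega>\<bar> * \<bar>Z \<omega>\<bar>) \<le> (Y \<omega>)\<^sup>2 + (Z \<omega>)\<^sup>2"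
      using sum_squares_bound[of "\<bar>Y \<omega>\<bar>" "\<bar>Z \<omega>\<bar>"] by (simp add: mult.assoc)
    moreover have "0 \<le> \<bar>Y \<omega>\<bar> * \<bar>Z \<omega>\<bar>" by simp
    ultimately have "\<bar>Y \<omega>\<bar> * \<bar>Z \<omega>\<bar> \<le> (Y \<omega>)\<^sup>2 + (Z \<omega>)\<^sup>2" by linarith
    then show "norm (Y \<omega> * Z \<omega>) \<le> norm ((Y \<omega>)\<^sup>2 + (Z \<omega>)\<^sup>2)"
      by (simp add: abs_mult)
  qed
qed

text \<open>The hypothesis \<open>normal\<close> is the system of normal equations: the combination
  with weights \<open>x N\<close> has covariance 1 with each of the first \<open>N\<close>
  variables. Its covariance with any combination of these is then the sum of the coefficients, and
  dividing by the total weight gives the best linear unbiased estimator.\<close>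

lemma (in prob_space) AE_blue_tendsto_0:
  fixes D :: "nat \<Rightarrow> 'a \<Rightarrow> real" and x :: "nat \<Rightarrow> nat \<Rightarrow> real" and r :: "nat \<Rightarrow> real"
  assumes gauss: "\<And>n c. centered_gaussian_rv M (\<lambda>\<omega>. \<Sum>i<n. c i * D i \<omega>)"
    and stat: "\<And>k j. expectation (\<lambda>\<omega>. D (k + j) \<omega> * D j \<omega>) = r k"
    and lim: "r \<longlonglongrightarrow> 0"
    and normal: "\<And>N j. j < N \<Longrightarrow> (\<Sum>i<N. x N i * expectation (\<lambda>\<omega>. D i \<omega> * D j \<omega>)) = 1"
  shows "\<And>N. N > 0 \<Longrightarrow> (\<Sum>i<N. x N i) > 0"
    and "AE \<omega> in M. (\<lambda>N. (\<Sum>i<N. x N i * D i \<omega>) / (\<Sum>i<N. x N i)) \<longlonglongrightarrow> 0"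
proof -
  define E where "E i j = expectation (\<lambda>\<omega>. D i \<omega> * D j \<omega>)" for i j
  have D_gauss: "centered_gaussian_rv M (D i)" for i
    using gauss[of "\<lambda>j. if j = i then 1 else 0" "Suc i"] by (simp add: if_distrib if_distribR cong: if_cong)
  have int_D: "integrable M (\<lambda>\<omega>. D i \<omega> * D j \<omega>)" for i j
    by (intro integrable_mult_centered_gaussian_rv D_gauss)

  define lc where "lc n c \<omega> = (\<Sum>i<n. c i * D i \<omega>)" for n :: nat and c :: "nat \<Rightarrow> real" and \<omega>
  \<comment> \<open>With the sum over \<open>i\<close> inside, the inner sum in \<open>E_lc\<close>
    becomes the left side of a normal equation.\<close>
  have lc_prod: "lc n c \<omega> * lc m d \<omega> = (\<Sum>j<m. \<Sum>i<n. d j * (c i * (D i \<omega> * D j \<omega>)))" for n c m d \<omega>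
    by (subst sum.swap) (simp add: lc_def sum_product mult.assoc mult.left_commute mult.commute)
  have int_lc: "integrable M (\<lambda>\<omega>. lc n c \<omega> * lc m d \<omega>)" for n c m d
    unfolding lc_prod using int_D by (intro Bochner_Integration.integrable_sum integrable_mult_right)
  have E_lc: "expectation (\<lambda>\<omega>. lc n c \<omega> * lc m d \<omega>) = (\<Sum>j<m. d j * (\<Sum>i<n. c i * E i j))" for n c m d
    unfolding lc_prod E_def using int_D by (simp add: sum_distrib_left)

  define Y where "Y N = lc N (x N)" for N
  define q where "q N = (\<Sum>i<N. x N i)" for N
  have E_Y: "expectation (\<lambda>\<omega>. Y N \<omega> * lc n c \<omega>) = (\<Sum>j<n. c j)" if "n \<le> N" for n N c
    unfolding Y_def E_lc using normal[folded E_def] that by (intro sum.cong) auto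
  have q_pos: "q N > 0" if "N > 0" for N
  proof -
    have eq: "expectation (\<lambda>\<omega>. Y N \<omega> * Y N \<omega>) = q N"
      using E_Y[of N N "x N"] by (simp add: Y_def q_def)
    \<comment> \<open>As \<open>q N\<close> is the second moment of \<open>Y N\<close>, its
      vanishing would make \<open>Y N\<close> zero almost surely, against covariance 1 with
      \<open>D 0\<close>, which is \<open>lc 1 (\<lambda>_. 1)\<close>.\<close>
    have "q N \<noteq> 0"
    proof
      assume "q N = 0"
      then have "AE \<omega> in M. Y N \<omega> * Y N \<omega> = 0"
        using integral_nonneg_eq_0_iff_AE[of M "\<lambda>\<omega>. Y N \<omega> * Y N \<omega>"] eq int_lc by (simp add: Y_def)
      then have "AE \<omega> in M. Y N \<omega> * lc 1 (\<lambda>_. 1) \<omega> = 0"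
        by (rule eventually_mono) simp
      then have "expectation (\<lambda>\<omega>. Y N \<omega> * lc 1 (\<lambda>_. 1) \<omega>) = 0"
        by (rule integral_eq_zero_AE)
      then show False using E_Y[of 1 N "\<lambda>_. 1"] that by simp
    qed
    moreover have "q N \<ge> 0" unfolding eq[symmetric] by (intro integral_nonneg_AE) simp
    ultimately show ?thesis by simp
  qed
  then show "(\<Sum>i<N. x N i) > 0" if "N > 0" for N
    using that by (simp add: q_def)

  \<comment> \<open>The index is shifted by one because for \<open>N = 0\<close> the denominator vanishes.\<close>
  define v where "v N = 1 / q (Suc N)" for N
  \<comment> \<open>Padding by 0 writes estimators for different sample sizes as combinations of a
    common length, so that their differences are again linear combinations.\<close>
  define w where "w N i = (if i < Suc N then x (Suc N) i / q (Suc N) else 0)" for N i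
  define Z where "Z N \<omega> = Y (Suc N) \<omega> / q (Suc N)" for N \<omega>
  have Z_lc: "Z N \<omega> = lc n (w N) \<omega>" if "N < n" for N n \<omega>
  proof -
    have "lc n (w N) \<omega> = (\<Sum>i<Suc N. w N i * D i \<omega>)"
      unfolding lc_def using that by (intro sum.mono_neutral_right) (auto simp: w_def)
    also have "\<dots> = (\<Sum>i<Suc N. x (Suc N) i * D i \<omega> / q (Suc N))"
      by (intro sum.cong) (auto simp: w_def)
    finally show ?thesis by (simp add: Z_def Y_def lc_def sum_divide_distrib del: sum.lessThan_Suc)
  qed
  have sum_w: "(\<Sum>i<Suc N. w N i) = 1" for N
  proof -
    have "(\<Sum>i<Suc N. w N i) = (\<Sum>i<Suc N. x (Suc N) i / q (Suc N))"
      by (intro sum.cong) (auto simp: w_def)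
    also have "\<dots> = q (Suc N) / q (Suc N)" unfolding q_def by (rule sum_divide_distrib[symmetric])
    finally show ?thesis using q_pos[of "Suc N"] by simp
  qed
  \<comment> \<open>For coefficients with sum 1 the value is \<open>v N\<close>, whatever the
    combination. Both \<open>E_diff\<close> and the comparison with the sparse average rest on
    this.\<close>
  have E_Z_lc: "expectation (\<lambda>\<omega>. Z N \<omega> * lc n c \<omega>) = (\<Sum>j<n. c j) * v N" if "n \<le> Suc N" for n N c
    using E_Y[OF that, of c] by (simp add: Z_def v_def)
  have E_Z: "expectation (\<lambda>\<omega>. Z N \<omega> * Z K \<omega>) = v N" if "K \<le> N" for N K
    using E_Z_lc[of "Suc K" N "w K"] that sum_w[of K] by (simp add: Z_lc[of K "Suc K"])
  have int_Z_lc: "integrable M (\<lambda>\<omega>. Z N \<omega> * lc n c \<omega>)" for N n c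
    using int_lc by (simp add: Z_lc[of N "Suc N"])
  have int_Z: "integrable M (\<lambda>\<omega>. Z N \<omega> * Z K \<omega>)" for N K
    using int_lc by (simp add: Z_lc[of N "Suc N"] Z_lc[of K "Suc K"])
  have E_diff: "expectation (\<lambda>\<omega>. (Z N \<omega> - Z K \<omega>)\<^sup>2) = v K - v N" if "K \<le> N" for N K
  proof -
    have "expectation (\<lambda>\<omega>. (Z N \<omega> - Z K \<omega>)\<^sup>2)
      = expectation (\<lambda>\<omega>. Z N \<omega> * Z N \<omega> - 2 * (Z N \<omega> * Z K \<omega>) + Z K \<omega> * Z K \<omega>)"
      by (intro Bochner_Integration.integral_cong) (auto simp: power2_eq_square algebra_simps)
    also have "\<dots> = v N - 2 * v N + v K"
      using int_Z E_Z that by simp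
    finally show ?thesis by simp
  qed
  have Z_gauss: "centered_gaussian_rv M (Z N)" for N
  proof -
    have "Z N = (\<lambda>\<omega>. \<Sum>i<Suc N. w N i * D i \<omega>)"
      using Z_lc[of N "Suc N"] unfolding lc_def by blast
    then show ?thesis using gauss[of "w N" "Suc N"] by (simp only:)
  qed
  have Z_diff_gauss: "centered_gaussian_rv M (\<lambda>\<omega>. Z N \<omega> - Z K \<omega>)" for N K
  proof -
    have "Z N \<omega> - Z K \<omega> = (\<Sum>i<Suc (max N K). (w N i - w K i) * D i \<omega>)" for \<omega>
      using Z_lc[of N "Suc (max N K)" \<omega>] Z_lc[of K "Suc (max N K)" \<omega>]
      unfolding lc_def by (simp add: left_diff_distrib sum_subtractf)
    then show ?thesis using gauss by presburger
  qed

  have "antimono v"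
  proof (rule antimonoI)
    fix K N :: nat assume "K \<le> N"
    have "v K - v N \<ge> 0" unfolding E_diff[OF \<open>K \<le> N\<close>, symmetric] by (intro integral_nonneg_AE) simp
    then show "v N \<le> v K" by simp
  qed
  have "v \<longlonglongrightarrow> 0"
  proof (rule LIMSEQ_I)
    fix \<epsilon> :: real assume "\<epsilon> > 0"
    \<comment> \<open>Diagonal and off-diagonal covariances will each contribute at most \<delta> to
      the variance of the average, and 2 * \<delta> < \<epsilon>.\<close>
    define \<delta> where "\<delta> = \<epsilon> / 3"
    have \<delta>: "\<delta> > 0" using \<open>\<epsilon> > 0\<close> by (simp add: \<delta>_def)
    obtain L where L: "\<And>k. k \<ge> L \<Longrightarrow> \<bar>r k\<bar> < \<delta>"
      using LIMSEQ_D[OF lim \<delta>] by auto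
    \<comment> \<open>The number of averaged increments: large enough for \<open>r 0 / m\<close> to
      be at most \<delta>, with \<open>Suc\<close> making it positive.\<close>
    define m where "m = Suc (nat \<lceil>r 0 / \<delta>\<rceil>)"
    have "r 0 / \<delta> \<le> real m" unfolding m_def by linarith
    then have m: "r 0 \<le> real m * \<delta>" "m > 0"
      using \<delta> by (simp_all add: field_simps m_def)
    \<comment> \<open>Weights, on the indices below \<open>n\<close>, of the average of every
      \<open>Suc L\<close>-th increment. Distinct members have a lag of at least
      \<open>Suc L\<close>, where \<open>r\<close> is below \<delta>.\<close>
    define d where "d i = (if Suc L dvd i then 1 / real m else 0)" for i
    define n where "n = m * Suc L"
    have sum_sparse: "(\<Sum>i<n. d i * g i) = (\<Sum>a<m. g (a * Suc L)) / m" for g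
    proof -
      have "(\<Sum>i<n. d i * g i) = (\<Sum>i\<in>(\<lambda>a. a * Suc L) ` {..<m}. d i * g i)"
      proof (intro sum.mono_neutral_right)
        show "(\<lambda>a. a * Suc L) ` {..<m} \<subseteq> {..<n}"
          by (auto simp: n_def simp del: mult_Suc_right)
        show "\<forall>i\<in>{..<n} - (\<lambda>a. a * Suc L) ` {..<m}. d i * g i = 0"
        proof
          fix i assume i: "i \<in> {..<n} - (\<lambda>a. a * Suc L) ` {..<m}"
          have "\<not> Suc L dvd i"
          proof
            assume "Suc L dvd i"
            then obtain a where "i = a * Suc L" by (metis dvdE mult.commute)
            with i show False by (auto simp: n_def simp del: mult_Suc_right)
          qed
          then show "d i * g i = 0" by (simp add: d_def)
        qed
      qed simp
      also have "\<dots> = (\<Sum>a<m. d (a * Suc L) * g (a * Suc L))"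
        by (subst sum.reindex) (auto simp: inj_on_def simp del: mult_Suc_right)
      also have "\<dots> = (\<Sum>a<m. g (a * Suc L) / m)"
        by (intro sum.cong) (auto simp: d_def simp del: mult_Suc_right)
      finally show ?thesis by (simp add: sum_divide_distrib)
    qed
    have E_sparse: "E (a * Suc L) (b * Suc L) \<le> (if a = b then r 0 else \<delta>)" for a b
    proof -
      have E_le: "E (a * Suc L) (b * Suc L) \<le> \<delta>" if "b < a" for a b
      proof -
        have "a * Suc L = (a - b) * Suc L + b * Suc L"
          using that by (simp add: add_mult_distrib[symmetric] del: mult_Suc_right)
        then have "E (a * Suc L) (b * Suc L) = r ((a - b) * Suc L)"
          using stat[of "(a - b) * Suc L" "b * Suc L"] by (simp only: E_def)
        moreover have "1 * Suc L \<le> (a - b) * Suc L"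
          using that by (intro mult_le_mono1) simp
        then have "L \<le> (a - b) * Suc L"
          by (rule order_trans[rotated]) simp
        ultimately show ?thesis using L[of "(a - b) * Suc L"] by linarith
      qed
      have "E i j = E j i" for i j by (simp add: E_def mult.commute)
      then show ?thesis
        using E_le[of a b] E_le[of b a] stat[of 0] by (cases a b rule: linorder_cases) (auto simp: E_def)
    qed
    have "expectation (\<lambda>\<omega>. lc n d \<omega> * lc n d \<omega>) = (\<Sum>b<m. (\<Sum>a<m. E (a * Suc L) (b * Suc L)) / m) / m"
      unfolding E_lc sum_sparse ..
    \<comment> \<open>Adding \<delta> on the diagonal too keeps the bound uniform, so the average
      over all m^2 entries is exactly \<open>r 0 / m + \<delta>\<close>.\<close>
    also have "\<dots> \<le> (\<Sum>b<m. (\<Sum>a<m. (if a = b then r 0 else 0) + \<delta>) / m) / m"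
      using \<delta> by (intro divide_right_mono sum_mono order_trans[OF E_sparse]) auto
    also have "\<dots> = r 0 / m + \<delta>"
      using m by (simp add: sum.distrib field_simps)
    also have "\<dots> \<le> 2 * \<delta>"
      using m by (simp add: field_simps)
    finally have A: "expectation (\<lambda>\<omega>. lc n d \<omega> * lc n d \<omega>) \<le> 2 * \<delta>" .
    have "norm (v N - 0) < \<epsilon>" if "n \<le> N" for N
    proof -
      \<comment> \<open>The weights \<open>d\<close> sum to 1, so the cross term is
        \<open>v N\<close> and nonnegativity of the square says that \<open>v N\<close> is at most
        the variance of the average.\<close>
      have "0 \<le> expectation (\<lambda>\<omega>. (Z N \<omega> - lc n d \<omega>)\<^sup>2)"
        by (intro integral_nonneg_AE) simp
      also have "\<dots> = expectation (\<lambda>\<omega>. Z N \<omega> * Z N \<omega> - 2 * (Z N \<omega> * lc n d \<omega>) + lc n d \<omega> * lc n d \<omega>)"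
        by (intro Bochner_Integration.integral_cong) (auto simp: power2_eq_square algebra_simps)
      also have "\<dots> = v N - 2 * v N + expectation (\<lambda>\<omega>. lc n d \<omega> * lc n d \<omega>)"
        using int_Z int_Z_lc int_lc E_Z[of N N] E_Z_lc[of n N d] that sum_sparse[of "\<lambda>_. 1"] m
        by simp
      finally have "v N \<le> 2 * \<delta>" using A by simp
      moreover have "v N > 0" using q_pos by (simp add: v_def)
      ultimately show ?thesis using \<open>\<epsilon> > 0\<close> by (simp add: \<delta>_def)
    qed
    then show "\<exists>n0. \<forall>n\<ge>n0. norm (v n - 0) < \<epsilon>" by blast
  qed
  have "AE \<omega> in M. (\<lambda>N. Z N \<omega>) \<longlonglongrightarrow> 0"
  proof (rule AE_tendsto_0_of_fourth_moments[where C = 3 and v = v])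
    show "expectation (\<lambda>\<omega>. (Z j \<omega> - Z i \<omega>) ^ 4) \<le> 3 * (v i - v j)\<^sup>2" if "i \<le> j" for i j
      using centered_gaussian_rv_moments(3)[OF Z_diff_gauss, of j i] E_diff[OF that] by simp
    show "expectation (\<lambda>\<omega>. Z i \<omega> ^ 4) \<le> 3 * (v i)\<^sup>2" for i
      using centered_gaussian_rv_moments(3)[OF Z_gauss, of i] E_Z[of i i] by (simp add: power2_eq_square)
  qed (use centered_gaussian_rv_moments(1) Z_gauss Z_diff_gauss \<open>antimono v\<close> \<open>v \<longlonglongrightarrow> 0\<close> in auto)
  \<comment> \<open>\<open>Z N\<close> is the ratio at \<open>Suc N\<close>, so the shift of index
    is undone here.\<close>
  then show "AE \<omega> in M. (\<lambda>N. (\<Sum>i<N. x N i * D i \<omega>) / (\<Sum>i<N. x N i)) \<longlonglongrightarrow> 0"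
    by (rule eventually_mono)
      (rule LIMSEQ_imp_Suc, simp only: Z_def Y_def lc_def q_def)
qed

section \<open>Increments of the process and their covariance matrix\<close>

lemma centered_gaussian_process_increments:
  fixes t s :: "nat \<Rightarrow> real"
  assumes "centered_gaussian_process M B" and "\<And>i. t i \<ge> 0" and "\<And>i. s i \<ge> 0"
  shows "centered_gaussian_rv M (\<lambda>\<omega>. \<Sum>i<n. c i * (B (t i) \<omega> - B (s i) \<omega>))"
proof -
  \<comment> \<open>Both families of times are concatenated, the second with negated coefficients,
    because \<open>centered_gaussian_process\<close> speaks of values rather than
    increments.\<close>
  define u where "u i = (if i < n then t i else s (i - n))" for i
  define d where "d i = (if i < n then c i else - c (i - n))" for i
  have split: "(\<Sum>i<n + k. g i) = (\<Sum>i<n. g i) + (\<Sum>i<k. g (n + i))" for g :: "nat \<Rightarrow> real" and k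
    by (induction k) simp_all
  have "(\<Sum>i<n + n. d i * B (u i) \<omega>) = (\<Sum>i<n. c i * (B (t i) \<omega> - B (s i) \<omega>))" for \<omega>
  proof -
    have "(\<Sum>i<n + n. d i * B (u i) \<omega>) = (\<Sum>i<n. d i * B (u i) \<omega>) + (\<Sum>i<n. d (n + i) * B (u (n + i)) \<omega>)"
      by (rule split)
    also have "\<dots> = (\<Sum>i<n. c i * (B (t i) \<omega> - B (s i) \<omega>))"
      by (simp add: d_def u_def right_diff_distrib sum_subtractf sum_negf)
    finally show ?thesis .
  qed
  moreover have "centered_gaussian_rv M (\<lambda>\<omega>. \<Sum>i<n + n. d i * B (u i) \<omega>)"
    using assms by (simp add: centered_gaussian_process_def u_def)
  ultimately show ?thesis by simp
qed

text \<open>The integrand depends only on three increments from a common starting time, whose joint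
  law is fixed by stationarity. With \<open>c = h\<close> and consecutive multiples of
  \<open>h\<close> for \<open>a\<close> and \<open>b\<close>, it makes the covariance of two
  increments a function of their lag.\<close>

lemma stationary_increments_expectation:
  assumes "stationary_increments M B" and B: "\<And>t. t \<ge> 0 \<Longrightarrow> B t \<in> borel_measurable M" and B0: "\<And>\<omega>. B 0 \<omega> = 0"
    and "s \<ge> 0" "a \<ge> 0" "b \<ge> 0" "c \<ge> 0"
  shows "(\<integral>\<omega>. (B (s + b) \<omega> - B (s + a) \<omega>) * (B (s + c) \<omega> - B s \<omega>) \<partial>M)
    = (\<integral>\<omega>. (B b \<omega> - B a \<omega>) * B c \<omega> \<partial>M)"
proof -
  define t where "t i = (if i = 0 then a else if i = 1 then b else c)" for i :: nat
  have t: "t i \<ge> 0" for i using assms by (simp add: t_def)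
  let ?P = "PiM {..<3} (\<lambda>_. borel) :: (nat \<Rightarrow> real) measure"
  define F where "F y = (y 1 - y 0) * y 2" for y :: "nat \<Rightarrow> real"
  have F [measurable]: "F \<in> borel_measurable ?P"
    unfolding F_def by measurable
  have [measurable]: "B (t i) \<in> borel_measurable M" "B (s + t i) \<in> borel_measurable M"
    "B s \<in> borel_measurable M" "B 0 \<in> borel_measurable M" for i
    using B t assms by auto
  have "distr M ?P (\<lambda>\<omega>. \<lambda>i\<in>{..<3}. B (s + t i) \<omega> - B s \<omega>) = distr M ?P (\<lambda>\<omega>. \<lambda>i\<in>{..<3}. B (t i) \<omega> - B 0 \<omega>)"
    using assms t by (simp add: stationary_increments_def)
  then have "integral\<^sup>L (distr M ?P (\<lambda>\<omega>. \<lambda>i\<in>{..<3}. B (s + t i) \<omega> - B s \<omega>)) F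
    = integral\<^sup>L (distr M ?P (\<lambda>\<omega>. \<lambda>i\<in>{..<3}. B (t i) \<omega> - B 0 \<omega>)) F"
    by simp
  then have "(\<integral>\<omega>. F (\<lambda>i\<in>{..<3}. B (s + t i) \<omega> - B s \<omega>) \<partial>M) = (\<integral>\<omega>. F (\<lambda>i\<in>{..<3}. B (t i) \<omega> - B 0 \<omega>) \<partial>M)"
    by (subst (asm) (1 2) integral_distr) (use F in measurable)
  then show ?thesis by (simp add: F_def t_def B0)
qed

text \<open>The covariance matrix of \<open>(B_{kh})\<close> is \<open>L \<Gamma> L\<^sup>T\<close> with the all-ones lower triangular \<open>L\<close>, because
  \<open>B_{kh}\<close> is the sum of the first \<open>k\<close> increments.\<close>
lemma det_partial_sums_nonzero:
  fixes E :: "nat \<Rightarrow> nat \<Rightarrow> real"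
  assumes "Determinant.det (mat N N (\<lambda>(i, j). \<Sum>k<Suc i. \<Sum>l<Suc j. E k l)) \<noteq> 0"
  shows "Determinant.det (mat N N (\<lambda>(i, j). E i j)) \<noteq> 0"
proof -
  define L :: "real mat" where "L = mat N N (\<lambda>(i, j). if j \<le> i then 1 else 0)"
  define G where "G = mat N N (\<lambda>(i, j). E i j)"
  have carrier: "L \<in> carrier_mat N N" "G \<in> carrier_mat N N" by (auto simp: L_def G_def)
  have restrict: "(\<Sum>k = 0..<N. if k \<le> i then g k else 0) = sum g {..<Suc i}" if "i < N" for i and g :: "nat \<Rightarrow> real"
    using that by (intro sum.mono_neutral_cong_right) (auto simp del: sum.lessThan_Suc)
  have "mat N N (\<lambda>(i, j). \<Sum>k<Suc i. \<Sum>l<Suc j. E k l) = L * (G * transpose_mat L)"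
  proof (rule eq_matI)
    fix i j assume "i < dim_row (L * (G * transpose_mat L))" "j < dim_col (L * (G * transpose_mat L))"
    then have ij: "i < N" "j < N" by (auto simp: L_def)
    have GL: "(G * transpose_mat L) $$ (k, j) = (\<Sum>l<Suc j. E k l)" if "k < N" for k
    proof -
      have "(G * transpose_mat L) $$ (k, j) = (\<Sum>l = 0..<N. if l \<le> j then E k l else 0)"
        using ij that by (auto simp: G_def L_def scalar_prod_def intro!: sum.cong)
      then show ?thesis using restrict[OF ij(2)] by simp
    qed
    have "(L * (G * transpose_mat L)) $$ (i, j) = (\<Sum>k = 0..<N. L $$ (i, k) * (G * transpose_mat L) $$ (k, j))"
      using ij carrier by (auto simp: scalar_prod_def intro!: sum.cong)
    also have "\<dots> = (\<Sum>k = 0..<N. if k \<le> i then (\<Sum>l<Suc j. E k l) else 0)"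
      using ij GL by (intro sum.cong) (auto simp: L_def)
    also have "\<dots> = (\<Sum>k<Suc i. \<Sum>l<Suc j. E k l)" by (rule restrict[OF ij(1)])
    finally show "mat N N (\<lambda>(i, j). \<Sum>k<Suc i. \<Sum>l<Suc j. E k l) $$ (i, j) = (L * (G * transpose_mat L)) $$ (i, j)"
      using ij by simp
  qed (auto simp: L_def)
  then have "Determinant.det (mat N N (\<lambda>(i, j). \<Sum>k<Suc i. \<Sum>l<Suc j. E k l))
    = Determinant.det L * (Determinant.det G * Determinant.det (transpose_mat L))"
    using carrier by (simp add: det_mult)
  then show ?thesis using assms by (auto simp: G_def)
qed

lemma mat_inverse_left:
  fixes A :: "'a :: field mat"
  assumes "A \<in> carrier_mat n n" and "Determinant.det A \<noteq> 0"
  shows "the (mat_inverse A) * A = 1\<^sub>m n" and "the (mat_inverse A) \<in> carrier_mat n n"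
proof -
  obtain G where "mat_inverse A = Some G"
    using det_non_zero_imp_unit[OF assms, of "()"] mat_inverse(1)[OF assms(1), of "()"]
    by (cases "mat_inverse A") auto
  then show "the (mat_inverse A) * A = 1\<^sub>m n" "the (mat_inverse A) \<in> carrier_mat n n"
    using mat_inverse(2)[OF assms(1), of G] by auto
qed

section \<open>The estimator as the true drift plus a weighted mean of the noise\<close>

theorem theorem2p7:
  fixes M :: "'a measure" and B X :: "real \<Rightarrow> 'a \<Rightarrow> real" and \<theta> h :: real
  assumes "prob_space M"
    and "centered_gaussian_process M B"
    and "stationary_increments M B"
    and "\<And>\<omega>. B 0 \<omega> = 0"
    and "\<And>t \<omega>. X t \<omega> = \<theta> * t + B t \<omega>"
    and "h > 0"
    and "\<And>N. Determinant.det (cov_B_mat M B h N) \<noteq> 0"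
    and "(\<lambda>k. \<integral>\<omega>. (B (real (Suc k) * h) \<omega> - B (real k * h) \<omega>) * B h \<omega> \<partial>M) \<longlonglongrightarrow> 0"
  shows "AE \<omega> in M. (\<lambda>N. theta_hat M B X h N \<omega>) \<longlonglongrightarrow> \<theta>"
proof -
  interpret prob_space M by fact
  note h = \<open>h > 0\<close>
  define D where "D i \<omega> = B (real (Suc i) * h) \<omega> - B (real i * h) \<omega>" for i \<omega>
  define r where "r k = expectation (\<lambda>\<omega>. D k \<omega> * B h \<omega>)" for k
  define E where "E i j = expectation (\<lambda>\<omega>. D i \<omega> * D j \<omega>)" for i j
  have B_gauss: "centered_gaussian_rv M (B t)" if "t \<ge> 0" for t
  proof -
    have "centered_gaussian_rv M (\<lambda>\<omega>. \<Sum>i<1::nat. 1 * (B t \<omega> - B 0 \<omega>))"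
      by (rule centered_gaussian_process_increments[OF assms(2)]) (use that in auto)
    then show ?thesis using assms(4) by simp
  qed
  have D_lc: "centered_gaussian_rv M (\<lambda>\<omega>. \<Sum>i<n. c i * D i \<omega>)" for n c
    unfolding D_def using h by (intro centered_gaussian_process_increments[OF assms(2)]) auto
  have D_gauss: "centered_gaussian_rv M (D i)" for i
    using D_lc[of "\<lambda>j. if j = i then 1 else 0" "Suc i"]
    by (simp add: if_distrib if_distribR cong: if_cong)
  have stat: "expectation (\<lambda>\<omega>. D (k + j) \<omega> * D j \<omega>) = r k" for k j
    using stationary_increments_expectation[OF assms(3) _ assms(4), of "real j * h" "real k * h" "real (Suc k) * h" h] h B_gauss
    by (simp add: D_def r_def centered_gaussian_rv_def algebra_simps)

  have B_sum: "B (real (Suc i) * h) \<omega> = (\<Sum>k<Suc i. D k \<omega>)" for i \<omega>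
    using sum_lessThan_telescope[of "\<lambda>k. B (real k * h) \<omega>" "Suc i"] assms(4) unfolding D_def by simp
  have int_D: "integrable M (\<lambda>\<omega>. D i \<omega> * D j \<omega>)" for i j
    by (intro integrable_mult_centered_gaussian_rv D_gauss)
  have "cov M (B (real (Suc i) * h)) (B (real (Suc j) * h)) = (\<Sum>k<Suc i. \<Sum>l<Suc j. E k l)" for i j
  proof -
    have "cov M (B (real (Suc i) * h)) (B (real (Suc j) * h))
      = expectation (\<lambda>\<omega>. (\<Sum>k<Suc i. D k \<omega>) * (\<Sum>l<Suc j. D l \<omega>))"
      using centered_gaussian_rv_moments(2)[OF B_gauss] h
      unfolding cov_def by (simp only: B_sum[symmetric]) simp
    also have "\<dots> = (\<Sum>k<Suc i. \<Sum>l<Suc j. E k l)"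
      unfolding sum_product E_def using int_D
      by (simp only: Bochner_Integration.integral_sum Bochner_Integration.integrable_sum)
    finally show ?thesis .
  qed
  then have cov_B: "cov_B_mat M B h N = mat N N (\<lambda>(i, j). \<Sum>k<Suc i. \<Sum>l<Suc j. E k l)" for N
    unfolding cov_B_mat_def by simp
  have det: "Determinant.det (mat N N (\<lambda>(i, j). E i j)) \<noteq> 0" for N
    using assms(7)[of N] unfolding cov_B by (rule det_partial_sums_nonzero)
  have Gamma: "Gamma_mat M B h N = mat N N (\<lambda>(i, j). E i j)" for N
    unfolding Gamma_mat_def D_def[symmetric] cov_def E_def
    using centered_gaussian_rv_moments(2)[OF D_gauss] by simp
  define G where "G N = the (mat_inverse (Gamma_mat M B h N))" for N
  have G: "G N * Gamma_mat M B h N = 1\<^sub>m N" "G N \<in> carrier_mat N N" for N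
    unfolding G_def using mat_inverse_left[of "Gamma_mat M B h N" N] det[of N] by (auto simp: Gamma)
  \<comment> \<open>The row vector of ones times the inverse of \<open>Gamma_mat\<close>;
    multiplying by \<open>Gamma_mat\<close> from the right returns the ones, which are the normal
    equations.\<close>
  define x where "x N i = (\<Sum>k<N. G N $$ (k, i))" for N i
  have normal: "(\<Sum>i<N. x N i * E i j) = 1" if "j < N" for N j
  proof -
    have "(\<Sum>i<N. x N i * E i j) = (\<Sum>k<N. \<Sum>i<N. G N $$ (k, i) * E i j)"
      unfolding x_def sum_distrib_right by (rule sum.swap)
    also have "\<dots> = (\<Sum>k<N. (G N * Gamma_mat M B h N) $$ (k, j))"
      using G(2)[of N] that by (intro sum.cong) (auto simp: Gamma scalar_prod_def lessThan_atLeast0 intro!: sum.cong)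
    also have "\<dots> = (\<Sum>k<N. if k = j then 1 else 0)"
      unfolding G(1) using that by (intro sum.cong) auto
    finally show ?thesis using that by simp
  qed
  \<comment> \<open>Serves the numerator, where \<open>y\<close> holds the increments of
    \<open>X\<close>, and the denominator, where \<open>y\<close> is constantly
    \<open>h\<close>.\<close>
  have weights: "scalar_prod (vec N (\<lambda>_. h)) (G N *\<^sub>v vec N y) = h * (\<Sum>i<N. x N i * y i)" for N y
  proof -
    have "scalar_prod (vec N (\<lambda>_. h)) (G N *\<^sub>v vec N y) = (\<Sum>k<N. h * (\<Sum>i<N. G N $$ (k, i) * y i))"
      using G(2)[of N] by (auto simp: scalar_prod_def lessThan_atLeast0 intro!: sum.cong)
    also have "\<dots> = h * (\<Sum>i<N. x N i * y i)"
      unfolding x_def sum_distrib_right sum_distrib_left[symmetric] by (subst sum.swap) simp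
    finally show ?thesis .
  qed
  have q_pos: "\<And>N. N > 0 \<Longrightarrow> (\<Sum>i<N. x N i) > 0"
    and conv: "AE \<omega> in M. (\<lambda>N. (\<Sum>i<N. x N i * D i \<omega>) / (\<Sum>i<N. x N i)) \<longlonglongrightarrow> 0"
    using AE_blue_tendsto_0[of D r x, OF D_lc stat _ normal[unfolded E_def]] assms(8)
    by (auto simp: r_def[abs_def] D_def)
  \<comment> \<open>For \<open>N > 0\<close> the total weight is positive, so the drift part of the
    numerator divides out to exactly \<theta>.\<close>
  have "theta_hat M B X h N \<omega> = \<theta> + ((\<Sum>i<N. x N i * D i \<omega>) / (\<Sum>i<N. x N i)) / h" if "N > 0" for N \<omega>
  proof -
    let ?q = "\<Sum>i<N. x N i"
    have "X (real (Suc i) * h) \<omega> - X (real i * h) \<omega> = \<theta> * h + D i \<omega>" for i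
      by (simp add: assms(5) D_def algebra_simps)
    then have "theta_hat M B X h N \<omega> = h * (\<Sum>i<N. x N i * (\<theta> * h + D i \<omega>)) / (h * (\<Sum>i<N. x N i * h))"
      unfolding theta_hat_def Let_def G_def[symmetric] incr_vec_def weights by simp
    also have "\<dots> = (\<theta> * h * ?q + (\<Sum>i<N. x N i * D i \<omega>)) / (h * ?q)"
    proof -
      have "(\<Sum>i<N. x N i * (\<theta> * h + D i \<omega>)) = \<theta> * h * ?q + (\<Sum>i<N. x N i * D i \<omega>)"
        by (simp add: distrib_left sum.distrib sum_distrib_left mult.commute)
      moreover have "(\<Sum>i<N. x N i * h) = ?q * h"
        by (rule sum_distrib_right[symmetric])
      ultimately show ?thesis using h by simp
    qed
    also have "\<dots> = \<theta> + ((\<Sum>i<N. x N i * D i \<omega>) / ?q) / h"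
      using h q_pos[OF that] by (simp add: field_simps)
    finally show ?thesis .
  qed
  then have eq: "eventually (\<lambda>N. \<theta> + ((\<Sum>i<N. x N i * D i \<omega>) / (\<Sum>i<N. x N i)) / h = theta_hat M B X h N \<omega>) sequentially" for \<omega>
    by (intro eventually_sequentiallyI[of 1]) simp
  show ?thesis
    using conv
  proof (rule eventually_mono)
    fix \<omega> assume "(\<lambda>N. (\<Sum>i<N. x N i * D i \<omega>) / (\<Sum>i<N. x N i)) \<longlonglongrightarrow> 0"
    then have "(\<lambda>N. \<theta> + ((\<Sum>i<N. x N i * D i \<omega>) / (\<Sum>i<N. x N i)) / h) \<longlonglongrightarrow> \<theta> + 0 / h"
      using h by (intro tendsto_intros) auto
    then show "(\<lambda>N. theta_hat M B X h N \<omega>) \<longlonglongrightarrow> \<theta>"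
      using Lim_transform_eventually[OF _ eq] by simp
  qed
qed

end
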